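(* Let $\mathbf{A}$ be a Hilbert algebra and $n \in \mathbb{N}$ (where $0\in\mathbb{N}$). Then $\mathbf{A}$ has depth $\leq n$ if and only if $\mathbf{A} \vDash d_n \approx 1$, that is, if and only if $d_n(a_0, \dots, a_n) = 1$ in $\mathbf{A}$ for all $a_0, \dots, a_n \in A$.
   Context: A Hilbert algebra is an algebra $\mathbf{A} = \langle A; \to \rangle$ with one binary operation that is an implicative subreduct of a Heyting algebra, i.e. (up to isomorphism) a subalgebra of the $\langle \to \rangle$-reduct of some Heyting algebra. In every Hilbert algebra $a \to a = b \to b$ for all $a, b$, and one sets $1 = a \to a$. The relation $a \leq b \iff a \to b = 1$ is a partial order on $A$ with maximum $1$. An implicative filter of $\mathbf{A}$ is a set $F \subseteq A$ such that $1 \in F$ and, for all $a, b \in A$, if $a \in F$ and $a \to b \in F$, then $b \in F$. Ordered by inclusion, the implicative filters of $\mathbf{A}$ form a distributive lattice $\mathsf{Fi}(\mathbf{A})$ (with maximum $A$ and with meet given by intersection). An element of a lattice is meet irreducible when it is neither the maximum of the lattice nor can be written as the meet of two (strictly) larger elements. $\mathbf{A}_*$ denotes the poset (under inclusion) of meet irreducible elements of $\mathsf{Fi}(\mathbf{A})$. For $n \in \mathbb{N}$, the Hilbert algebra $\mathbf{A}$ has depth $\leq n$ when $\mathbf{A}_*$ does not contain any chain of length $n+1$, i.e. there are no $n+1$ elements $F_0 \subsetneq F_1 \subsetneq \dots \subsetneq F_n$ of $\mathbf{A}_*$ (in particular, depth $\leq 0$ means $\mathbf{A}_*$ is empty). The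 terms $d_n(x_0, \dots, x_n)$ are defined recursively by $$d_0(x_0) = x_0, \qquad d_{n+1}(x_0, \dots, x_{n+1}) = \big((x_{n+1} \to d_n(x_0, \dots, x_n)) \to x_{n+1}\big) \to x_{n+1}.$$ *)

theory Defs
  imports "HOL-Algebra.Lattice"
begin

locale heyting_algebra = bounded_lattice L for L (structure) +
  fixes himp :: "'a \<Rightarrow> 'a \<Rightarrow> 'a"
  assumes himp_closed:
      "\<lbrakk>x \<in> carrier L; y \<in> carrier L\<rbrakk> \<Longrightarrow> himp x y \<in> carrier L"
    and residuation:
      "\<lbrakk>x \<in> carrier L; y \<in> carrier L; z \<in> carrier L\<rbrakk>
        \<Longrightarrow> x \<sqinter> y \<sqsubseteq> z \<longleftrightarrow> x \<sqsubseteq> himp y z"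

text \<open>An algebra with one binary operation is given by its universe \<open>A\<close> and an operation
  \<open>imp\<close>, whose values matter on \<open>A\<close> only. As a formula of HOL cannot quantify over types, the
  type over which the Heyting algebra is sought is a parameter of the predicate; a theorem
  assuming \<open>hilbert_algebra TYPE('b) A imp\<close> with \<open>'b\<close> a type variable therefore covers all
  implicative subreducts of Heyting algebras over arbitrary types.\<close>

definition hilbert_algebra :: "'b itself \<Rightarrow> 'a set \<Rightarrow> ('a \<Rightarrow> 'a \<Rightarrow> 'a) \<Rightarrow> bool" where
  "hilbert_algebra (_ :: 'b itself) A imp \<longleftrightarrow>
     A \<noteq> {} \<and> (\<forall>a\<in>A. \<forall>b\<in>A. imp a b \<in> A) \<and>
     (\<exists>(H :: 'b gorder) himp h. heyting_algebra H himp \<and>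
        h ` A \<subseteq> carrier H \<and> inj_on h A \<and>
        (\<forall>a\<in>A. \<forall>b\<in>A. h (imp a b) = himp (h a) (h b)))"

definition hilbert_one :: "'a set \<Rightarrow> ('a \<Rightarrow> 'a \<Rightarrow> 'a) \<Rightarrow> 'a" where
  "hilbert_one A imp = (THE e. \<forall>a\<in>A. imp a a = e)"

definition implicative_filter :: "'a set \<Rightarrow> ('a \<Rightarrow> 'a \<Rightarrow> 'a) \<Rightarrow> 'a set \<Rightarrow> bool" where
  "implicative_filter A imp F \<longleftrightarrow>
     F \<subseteq> A \<and> hilbert_one A imp \<in> F \<and>
     (\<forall>a\<in>A. \<forall>b\<in>A. a \<in> F \<and> imp a b \<in> F \<longrightarrow> b \<in> F)"

definition filter_lattice :: "'a set \<Rightarrow> ('a \<Rightarrow> 'a \<Rightarrow> 'a) \<Rightarrow> 'a set gorder" where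
  "filter_lattice A imp =
     \<lparr>carrier = {F. implicative_filter A imp F}, eq = (=), le = (\<subseteq>)\<rparr>"

definition meet_irreducible :: "('c, 'm) gorder_scheme \<Rightarrow> 'c \<Rightarrow> bool" where
  "meet_irreducible L x \<longleftrightarrow>
     x \<in> carrier L \<and> x \<noteq> \<top>\<^bsub>L\<^esub> \<and>
     \<not> (\<exists>y\<in>carrier L. \<exists>z\<in>carrier L. x \<sqsubset>\<^bsub>L\<^esub> y \<and> x \<sqsubset>\<^bsub>L\<^esub> z \<and> x = y \<sqinter>\<^bsub>L\<^esub> z)"

text \<open>The underlying set of the dual poset of the algebra; its order is inclusion.\<close>

definition hilbert_dual :: "'a set \<Rightarrow> ('a \<Rightarrow> 'a \<Rightarrow> 'a) \<Rightarrow> 'a set set" where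
  "hilbert_dual A imp = {F. meet_irreducible (filter_lattice A imp) F}"

definition depth_le :: "'a set \<Rightarrow> ('a \<Rightarrow> 'a \<Rightarrow> 'a) \<Rightarrow> nat \<Rightarrow> bool" where
  "depth_le A imp n \<longleftrightarrow>
     \<not> (\<exists>F :: nat \<Rightarrow> 'a set. (\<forall>i\<le>n. F i \<in> hilbert_dual A imp) \<and> (\<forall>i<n. F i \<subset> F (Suc i)))"

text \<open>The value of the term \<open>d\<^sub>n\<close> when each variable \<open>x\<^sub>i\<close> is assigned \<open>a i\<close>.\<close>

primrec d_term :: "('a \<Rightarrow> 'a \<Rightarrow> 'a) \<Rightarrow> nat \<Rightarrow> (nat \<Rightarrow> 'a) \<Rightarrow> 'a" where
  "d_term imp 0 a = a 0"
| "d_term imp (Suc n) a =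
     imp (imp (imp (a (Suc n)) (d_term imp n a)) (a (Suc n))) (a (Suc n))"

end

theory Submission
  imports Defs
begin

text \<open>For a filter \<open>F\<close>, the filter generated by \<open>F\<close> and \<open>a\<close> is \<open>{c. a \<rightarrow> c \<in> F}\<close>.

  Given a chain \<open>F\<^sub>0 \<subset> F\<^sub>1 \<subset> \<dots>\<close> of meet irreducible filters and \<open>d \<notin> F\<^sub>1\<close>, pick \<open>c \<in> F\<^sub>1 - F\<^sub>0\<close>. Then
  neither \<open>c\<close> nor \<open>c \<rightarrow> d\<close> is in \<open>F\<^sub>0\<close>, so by irreducibility some \<open>x \<notin> F\<^sub>0\<close> lies above both of them
  modulo \<open>F\<^sub>0\<close>. As \<open>x \<rightarrow> d \<le> c \<rightarrow> d \<le> x\<close> modulo \<open>F\<^sub>0\<close>, we get \<open>((x \<rightarrow> d) \<rightarrow> x) \<rightarrow> x \<notin> F\<^sub>0\<close>; iterating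
  along the chain refutes \<open>d\<^sub>n \<approx> 1\<close>.

  Conversely, if \<open>((x \<rightarrow> d) \<rightarrow> x) \<rightarrow> x \<notin> G\<close>, Zorn's lemma gives a meet irreducible \<open>F\<^sub>0 \<supseteq> G\<close> that
  contains \<open>(x \<rightarrow> d) \<rightarrow> x\<close> and omits \<open>x\<close>. Then \<open>x \<rightarrow> d \<notin> F\<^sub>0\<close>, so the filter generated by \<open>F\<^sub>0\<close> and \<open>x\<close>
  omits \<open>d\<close>, and the rest of the chain is built above it.\<close>

section \<open>Implication in Heyting algebras\<close>

context heyting_algebra
begin

lemma himp_mp:
  assumes "t \<in> carrier L" "y \<in> carrier L" "z \<in> carrier L" "t \<sqsubseteq> himp y z" "t \<sqsubseteq> y"
  shows "t \<sqsubseteq> z"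
proof -
  have "t \<sqinter> y \<sqsubseteq> z"
    using residuation assms by blast
  moreover have "t \<sqsubseteq> t \<sqinter> y"
    using assms by (simp add: meet_le)
  ultimately show ?thesis
    using assms by (meson le_trans meet_closed)
qed

text \<open>Testing the inequality on all elements \<open>s\<close> below \<open>t\<close> makes
  \<open>t\<close> act as a context. With \<open>himp_mp\<close> as the elimination rule, K and S
  are then proved as in natural deduction.\<close>

lemma himp_intro:
  assumes "t \<in> carrier L" "y \<in> carrier L" "z \<in> carrier L"
    and "\<And>s. \<lbrakk>s \<in> carrier L; s \<sqsubseteq> t; s \<sqsubseteq> y\<rbrakk> \<Longrightarrow> s \<sqsubseteq> z"
  shows "t \<sqsubseteq> himp y z"
  using assms residuation[of t y z] meet_left[of t y] meet_right[of t y] by simp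

lemma himp_eq_top_iff:
  assumes "x \<in> carrier L" "y \<in> carrier L"
  shows "himp x y = \<top> \<longleftrightarrow> x \<sqsubseteq> y"
proof
  assume "himp x y = \<top>"
  then show "x \<sqsubseteq> y"
    using himp_mp[of x x y] assms by (simp add: top_higher)
next
  assume xy: "x \<sqsubseteq> y"
  have "\<top> \<sqsubseteq> himp x y"
    using assms xy by (intro himp_intro) (auto intro: le_trans)
  then show "himp x y = \<top>"
    using assms by (simp add: himp_closed le_antisym top_higher)
qed

lemma himp_K:
  assumes "x \<in> carrier L" "y \<in> carrier L"
  shows "x \<sqsubseteq> himp y x"
  using assms by (intro himp_intro)

lemma himp_S:
  assumes x: "x \<in> carrier L" and y: "y \<in> carrier L" and z: "z \<in> carrier L"
  shows "himp x (himp y z) \<sqsubseteq> himp (himp x y) (himp x z)"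
proof (intro himp_intro himp_closed assms)
  fix s u
  assume s: "s \<in> carrier L" "s \<sqsubseteq> himp x (himp y z)" "s \<sqsubseteq> himp x y"
    and u: "u \<in> carrier L" "u \<sqsubseteq> s" "u \<sqsubseteq> x"
  have "u \<sqsubseteq> himp x (himp y z)" "u \<sqsubseteq> himp x y"
    using s u assms by (meson himp_closed le_trans)+
  then have "u \<sqsubseteq> himp y z" "u \<sqsubseteq> y"
    using u assms himp_closed himp_mp by blast+
  then show "u \<sqsubseteq> z"
    using u assms himp_mp by blast
qed

end

section \<open>Hilbert algebras by axioms, and their filters\<close>

unbundle no funcset_syntax

text \<open>The axioms K and S, with detachment from the unit, replace the embedding into a Heyting
  algebra in all arguments about filters.\<close>

locale hilbert_system =
  fixes A :: "'a set" and imp :: "'a \<Rightarrow> 'a \<Rightarrow> 'a" (infixr \<open>\<rightarrow>\<close> 60) and one :: 'a (\<open>\<one>\<close>)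
  assumes imp_closed [simp]: "\<lbrakk>a \<in> A; b \<in> A\<rbrakk> \<Longrightarrow> a \<rightarrow> b \<in> A"
    and one_closed [simp]: "\<one> \<in> A"
    and imp_refl [simp]: "a \<in> A \<Longrightarrow> a \<rightarrow> a = \<one>"
    and imp_K: "\<lbrakk>a \<in> A; b \<in> A\<rbrakk> \<Longrightarrow> a \<rightarrow> b \<rightarrow> a = \<one>"
    and imp_S: "\<lbrakk>a \<in> A; b \<in> A; c \<in> A\<rbrakk> \<Longrightarrow> (a \<rightarrow> b \<rightarrow> c) \<rightarrow> (a \<rightarrow> b) \<rightarrow> a \<rightarrow> c = \<one>"
    and one_detach: "\<lbrakk>a \<in> A; \<one> \<rightarrow> a = \<one>\<rbrakk> \<Longrightarrow> a = \<one>"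
begin

lemma hilbert_one_eq: "hilbert_one A imp = \<one>"
  unfolding hilbert_one_def by (rule the_equality) (simp, metis one_closed imp_refl)

abbreviation filt :: "'a set \<Rightarrow> bool" where
  "filt \<equiv> implicative_filter A imp"

lemma filtI:
  assumes "F \<subseteq> A" "\<one> \<in> F" "\<And>a b. \<lbrakk>a \<in> F; b \<in> A; a \<rightarrow> b \<in> F\<rbrakk> \<Longrightarrow> b \<in> F"
  shows "filt F"
  unfolding implicative_filter_def hilbert_one_eq using assms by meson

lemma filt_subset: "filt F \<Longrightarrow> F \<subseteq> A"
  by (simp add: implicative_filter_def)

lemma filt_sub: "filt F \<Longrightarrow> a \<in> F \<Longrightarrow> a \<in> A"
  using filt_subset by blast

lemma filt_one: "filt F \<Longrightarrow> \<one> \<in> F"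
  by (simp add: implicative_filter_def hilbert_one_eq)

lemma filt_mp: "\<lbrakk>filt F; a \<rightarrow> b \<in> F; a \<in> F; b \<in> A\<rbrakk> \<Longrightarrow> b \<in> F"
  unfolding implicative_filter_def by (meson subsetD)

lemma filt_weaken: "\<lbrakk>filt F; b \<in> F; a \<in> A\<rbrakk> \<Longrightarrow> a \<rightarrow> b \<in> F"
  by (metis filt_mp filt_one filt_sub imp_K imp_closed)

lemma filt_distrib:
  "\<lbrakk>filt F; a \<rightarrow> b \<rightarrow> c \<in> F; a \<rightarrow> b \<in> F; a \<in> A; b \<in> A; c \<in> A\<rbrakk> \<Longrightarrow> a \<rightarrow> c \<in> F"
  by (metis filt_mp filt_one imp_S imp_closed)

lemma filt_trans:
  "\<lbrakk>filt F; a \<rightarrow> b \<in> F; b \<rightarrow> c \<in> F; a \<in> A; b \<in> A; c \<in> A\<rbrakk> \<Longrightarrow> a \<rightarrow> c \<in> F"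
  by (meson filt_distrib filt_weaken imp_closed)

lemma filt_antimono:
  assumes "filt F" "a \<rightarrow> b \<in> F" "a \<in> A" "b \<in> A" "c \<in> A"
  shows "(b \<rightarrow> c) \<rightarrow> a \<rightarrow> c \<in> F"
proof -
  \<comment> \<open>K puts the premise \<open>a\<close> in front of
    \<open>b \<rightarrow> c\<close>, and S distributes it. This leaves
    \<open>a \<rightarrow> b\<close> to be discharged, which holds modulo \<open>F\<close>.\<close>
  have "(b \<rightarrow> c) \<rightarrow> a \<rightarrow> b \<rightarrow> c \<in> F"
    using assms by (simp add: filt_one imp_K)
  moreover have "(a \<rightarrow> b \<rightarrow> c) \<rightarrow> (a \<rightarrow> b) \<rightarrow> a \<rightarrow> c \<in> F"
    using assms by (simp add: filt_one imp_S)
  ultimately have "(b \<rightarrow> c) \<rightarrow> (a \<rightarrow> b) \<rightarrow> a \<rightarrow> c \<in> F"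
    using filt_trans assms by (meson imp_closed)
  moreover have "(b \<rightarrow> c) \<rightarrow> a \<rightarrow> b \<in> F"
    using assms by (simp add: filt_weaken)
  ultimately show ?thesis
    using filt_distrib assms by (meson imp_closed)
qed

lemma filt_A: "filt A"
  by (rule filtI) auto

text \<open>For this set, closure under detachment is \<open>one_detach\<close>. It turns "different
  from the unit" into "omitted by a filter".\<close>

lemma filt_singleton_one: "filt {\<one>}"
  by (rule filtI) (auto dest: one_detach)

lemma filt_Int: "\<lbrakk>filt F; filt G\<rbrakk> \<Longrightarrow> filt (F \<inter> G)"
  by (rule filtI; use filt_sub filt_one filt_mp in \<open>metis Int_iff subsetI\<close>)

lemma filt_Union_chain:
  assumes "C \<noteq> {}" "subset.chain {F. filt F} C"
  shows "filt (\<Union>C)"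
proof (rule filtI)
  have C: "\<And>F. F \<in> C \<Longrightarrow> filt F" and lin: "\<And>F G. \<lbrakk>F \<in> C; G \<in> C\<rbrakk> \<Longrightarrow> F \<subseteq> G \<or> G \<subseteq> F"
    using assms by (auto simp: subset_chain_def)
  show "\<Union>C \<subseteq> A"
    using C filt_sub by (meson Union_iff subsetI)
  show "\<one> \<in> \<Union>C"
    using C assms(1) filt_one by (meson UnionI ex_in_conv)
  fix a b
  assume "a \<in> \<Union>C" "b \<in> A" "a \<rightarrow> b \<in> \<Union>C"
  then obtain F G where "F \<in> C" "a \<in> F" "G \<in> C" "a \<rightarrow> b \<in> G"
    by blast
  then obtain H where "H \<in> C" "a \<in> H" "a \<rightarrow> b \<in> H"
    using lin by (metis subsetD)
  then show "b \<in> \<Union>C"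
    using C \<open>b \<in> A\<close> filt_mp by (meson UnionI)
qed

definition adjoin :: "'a set \<Rightarrow> 'a \<Rightarrow> 'a set" where
  "adjoin F a = {c \<in> A. a \<rightarrow> c \<in> F}"

text \<open>Closure under detachment is axiom S read modulo \<open>F\<close>, as in the deduction
  theorem.\<close>

lemma filt_adjoin: "\<lbrakk>filt F; a \<in> A\<rbrakk> \<Longrightarrow> filt (adjoin F a)"
  unfolding adjoin_def
  by (rule filtI; use filt_weaken filt_one filt_distrib one_closed in blast)

lemma subset_adjoin: "\<lbrakk>filt F; a \<in> A\<rbrakk> \<Longrightarrow> F \<subseteq> adjoin F a"
  by (auto simp: adjoin_def filt_weaken filt_sub)

lemma mem_adjoin: "\<lbrakk>filt F; a \<in> A\<rbrakk> \<Longrightarrow> a \<in> adjoin F a"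
  by (simp add: adjoin_def filt_one)

lemma psubset_adjoin: "\<lbrakk>filt F; a \<in> A; a \<notin> F\<rbrakk> \<Longrightarrow> F \<subset> adjoin F a"
  using subset_adjoin mem_adjoin by blast

section \<open>The filter lattice and its meet irreducible elements\<close>

lemma top_filter_lattice: "\<top>\<^bsub>filter_lattice A imp\<^esub> = A"
  unfolding top_def
proof (rule some_equality)
  show "greatest (filter_lattice A imp) A (carrier (filter_lattice A imp))"
    using filt_A filt_subset by (simp add: greatest_def filter_lattice_def)
  show "x = A" if "greatest (filter_lattice A imp) x (carrier (filter_lattice A imp))" for x
    using that filt_A filt_subset by (simp add: greatest_def filter_lattice_def subset_antisym)
qed

lemma meet_filter_lattice:
  assumes "filt F" "filt G"
  shows "F \<sqinter>\<^bsub>filter_lattice A imp\<^esub> G = F \<inter> G"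
  unfolding meet_def inf_def
proof (rule some_equality)
  let ?P = "\<lambda>x. greatest (filter_lattice A imp) x (Lower (filter_lattice A imp) {F, G})"
  show "?P (F \<inter> G)"
    using assms filt_Int by (auto simp: greatest_def Lower_def filter_lattice_def)
  show "x = F \<inter> G" if "?P x" for x
  proof
    show "x \<subseteq> F \<inter> G"
      using that assms by (auto simp: greatest_def Lower_def filter_lattice_def)
    show "F \<inter> G \<subseteq> x"
      using that assms filt_Int[OF assms] unfolding greatest_def Lower_def filter_lattice_def
      by auto
  qed
qed

lemma mem_hilbert_dual_iff:
  "F \<in> hilbert_dual A imp \<longleftrightarrow>
     filt F \<and> F \<noteq> A \<and> (\<forall>G H. filt G \<longrightarrow> filt H \<longrightarrow> F \<subset> G \<longrightarrow> F \<subset> H \<longrightarrow> F \<noteq> G \<inter> H)"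
proof -
  have "carrier (filter_lattice A imp) = {F. filt F}"
    "\<And>F G. F \<sqsubset>\<^bsub>filter_lattice A imp\<^esub> G \<longleftrightarrow> F \<subset> G"
    by (auto simp: filter_lattice_def lless_def)
  then have "F \<in> hilbert_dual A imp \<longleftrightarrow> filt F \<and> F \<noteq> A \<and>
      (\<forall>G. F \<subset> G \<longrightarrow> filt G \<longrightarrow> (\<forall>H. F \<subset> H \<longrightarrow> filt H \<longrightarrow> F \<noteq> G \<inter> H))"
    by (simp add: hilbert_dual_def meet_irreducible_def top_filter_lattice meet_filter_lattice
        Bex_def cong: conj_cong)
  then show ?thesis
    by metis
qed

text \<open>Adjoining \<open>a\<close> or \<open>b\<close> enlarges \<open>F\<close> strictly, so by
  irreducibility the two enlargements meet in more than \<open>F\<close>. Any extra element of the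
  intersection serves as \<open>x\<close>.\<close>

lemma hilbert_dual_upper_bound:
  assumes F: "F \<in> hilbert_dual A imp" and "a \<in> A" "b \<in> A" "a \<notin> F" "b \<notin> F"
  obtains x where "x \<in> A" "x \<notin> F" "a \<rightarrow> x \<in> F" "b \<rightarrow> x \<in> F"
proof -
  have filt: "filt F"
    using F by (simp add: mem_hilbert_dual_iff)
  have "F \<noteq> adjoin F a \<inter> adjoin F b"
    using F assms filt filt_adjoin psubset_adjoin by (simp add: mem_hilbert_dual_iff)
  moreover have "F \<subseteq> adjoin F a \<inter> adjoin F b"
    using assms filt subset_adjoin by blast
  ultimately obtain x where "x \<in> adjoin F a" "x \<in> adjoin F b" "x \<notin> F"
    by blast
  then show thesis
    using that by (auto simp: adjoin_def)
qed

text \<open>Zorn's lemma gives a filter maximal among those that extend \<open>G\<close> and omit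
  \<open>e\<close>. All strictly larger filters contain \<open>e\<close>, hence so does the
  intersection of any two of them, which thus differs from the maximal one.\<close>

lemma separating_hilbert_dual:
  assumes G: "filt G" and e: "e \<in> A" "e \<notin> G"
  obtains F where "F \<in> hilbert_dual A imp" "G \<subseteq> F" "e \<notin> F"
proof -
  let ?S = "{F. filt F \<and> G \<subseteq> F \<and> e \<notin> F}"
  have "\<exists>M\<in>?S. \<forall>X\<in>?S. M \<subseteq> X \<longrightarrow> X = M"
  proof (rule subset_Zorn_nonempty)
    show "?S \<noteq> {}"
      using assms by blast
    fix C
    assume "C \<noteq> {}" and C: "subset.chain ?S C"
    moreover have "subset.chain {F. filt F} C"
      using C by (auto simp: subset_chain_def)
    ultimately have "filt (\<Union>C)"
      by (intro filt_Union_chain)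
    then show "\<Union>C \<in> ?S"
      using \<open>C \<noteq> {}\<close> C by (auto simp: subset_chain_def)
  qed
  then obtain M where M: "filt M" "G \<subseteq> M" "e \<notin> M"
    and maximal: "\<forall>X\<in>?S. M \<subseteq> X \<longrightarrow> X = M"
    by (elim bexE CollectE conjE)
  have "e \<in> X" if "filt X" "M \<subset> X" for X
    using that M(2) maximal by auto
  then have "M \<in> hilbert_dual A imp"
    unfolding mem_hilbert_dual_iff using M e by (metis IntI)
  then show thesis
    using that M by simp
qed

section \<open>The terms \<open>d_term\<close> and chains of irreducible filters\<close>

lemma d_term_closed: "(\<forall>i\<le>n. a i \<in> A) \<Longrightarrow> d_term imp n a \<in> A"
  by (induction n) auto

lemma d_term_cong: "(\<forall>i\<le>n. a i = b i) \<Longrightarrow> d_term imp n a = d_term imp n b"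
  by (induction n) auto

text \<open>Omission from \<open>F 0\<close> is the form that the induction can pass down. The
  hypothesis is applied to the tail starting at \<open>F 1\<close>, so the last variable belongs to
  the smallest filter.\<close>

lemma d_term_refuted_by_chain:
  assumes "\<forall>i\<le>n. F i \<in> hilbert_dual A imp" "\<forall>i<n. F i \<subset> F (Suc i)"
  shows "\<exists>a. (\<forall>i\<le>n. a i \<in> A) \<and> d_term imp n a \<notin> F 0"
  using assms
proof (induction n arbitrary: F)
  case 0
  then have "\<exists>c\<in>A. c \<notin> F 0"
    by (auto simp: mem_hilbert_dual_iff dest: filt_sub)
  then show ?case
    by auto
next
  case (Suc n)
  have dual: "F 0 \<in> hilbert_dual A imp" "F 1 \<in> hilbert_dual A imp" and "F 0 \<subset> F 1"
    using Suc.prems by auto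
  then have filt: "filt (F 0)" "filt (F 1)"
    by (auto simp: mem_hilbert_dual_iff)
  obtain a where a: "\<forall>i\<le>n. a i \<in> A" "d_term imp n a \<notin> F 1"
    using Suc.IH[of "\<lambda>i. F (Suc i)"] Suc.prems by auto
  let ?d = "d_term imp n a"
  have d: "?d \<in> A"
    using a by (simp add: d_term_closed)
  obtain c where c: "c \<in> F 1" "c \<notin> F 0" "c \<in> A"
    using \<open>F 0 \<subset> F 1\<close> filt filt_sub by blast
  \<comment> \<open>Otherwise detachment inside \<open>F 1\<close>, which contains \<open>c\<close>,
    would put \<open>?d\<close> there.\<close>
  have "c \<rightarrow> ?d \<notin> F 0"
    using \<open>F 0 \<subset> F 1\<close> filt a c d filt_mp by blast
  then obtain x where x: "x \<in> A" "x \<notin> F 0" "c \<rightarrow> x \<in> F 0" "(c \<rightarrow> ?d) \<rightarrow> x \<in> F 0"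
    using hilbert_dual_upper_bound[OF dual(1), of c "c \<rightarrow> ?d"] c d imp_closed by metis
  \<comment> \<open>Antimonotonicity applied to \<open>c \<rightarrow> x\<close> gives
    \<open>(x \<rightarrow> ?d) \<rightarrow> c \<rightarrow> ?d\<close> modulo \<open>F 0\<close>,
    which composes with \<open>(c \<rightarrow> ?d) \<rightarrow> x\<close>.\<close>
  have "(x \<rightarrow> ?d) \<rightarrow> x \<in> F 0"
    using filt_trans[OF filt(1) filt_antimono] filt x c d by simp
  then have "((x \<rightarrow> ?d) \<rightarrow> x) \<rightarrow> x \<notin> F 0"
    using filt filt_mp x by blast
  moreover define b where "b = a(Suc n := x)"
  moreover have "d_term imp n b = ?d"
    unfolding b_def by (rule d_term_cong) auto
  moreover have "\<forall>i\<le>Suc n. b i \<in> A"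
    using a(1) x(1) by (simp add: b_def le_Suc_eq)
  ultimately have "d_term imp (Suc n) b \<notin> F 0"
    by simp
  then show ?case
    using \<open>\<forall>i\<le>Suc n. b i \<in> A\<close> by blast
qed

text \<open>The clause \<open>G \<subseteq> F 0\<close> links successive steps: used for the filter
  generated by the new bottom element and \<open>?x\<close>, it makes the inclusion into the rest of
  the chain strict.\<close>

lemma chain_from_d_term:
  assumes "filt G" "\<forall>i\<le>n. a i \<in> A" "d_term imp n a \<notin> G"
  shows "\<exists>F. (\<forall>i\<le>n. F i \<in> hilbert_dual A imp) \<and> (\<forall>i<n. F i \<subset> F (Suc i)) \<and> G \<subseteq> F 0"
  using assms
proof (induction n arbitrary: G)
  case 0
  then obtain F where "F \<in> hilbert_dual A imp" "G \<subseteq> F"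
    using separating_hilbert_dual[of G "a 0"] by auto
  then show ?case
    by (intro exI[of _ "\<lambda>_. F"]) auto
next
  case (Suc n)
  let ?d = "d_term imp n a" and ?x = "a (Suc n)"
  let ?u = "(?x \<rightarrow> ?d) \<rightarrow> ?x"
  have mem: "?d \<in> A" "?x \<in> A" "?u \<in> A"
    using Suc.prems by (simp_all add: d_term_closed)
  \<comment> \<open>Membership would mean \<open>?u \<rightarrow> ?x \<in> G\<close>, and
    \<open>?u \<rightarrow> ?x\<close> is the value of the term at \<open>Suc n\<close>.\<close>
  have "?x \<notin> adjoin G ?u"
    using Suc.prems by (simp add: adjoin_def)
  then obtain F0 where F0: "F0 \<in> hilbert_dual A imp" "adjoin G ?u \<subseteq> F0" "?x \<notin> F0"
    using separating_hilbert_dual[OF filt_adjoin] Suc.prems(1) mem by metis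
  then have filt: "filt F0"
    by (simp add: mem_hilbert_dual_iff)
  have "?u \<in> F0" "G \<subseteq> F0"
    using F0(2) mem_adjoin[OF Suc.prems(1) mem(3)] subset_adjoin[OF Suc.prems(1) mem(3)] by auto
  have "?x \<rightarrow> ?d \<notin> F0"
    using filt filt_mp \<open>?u \<in> F0\<close> F0 mem by blast
  then have "?d \<notin> adjoin F0 ?x"
    by (simp add: adjoin_def)
  then obtain F where F: "\<forall>i\<le>n. F i \<in> hilbert_dual A imp" "\<forall>i<n. F i \<subset> F (Suc i)"
    "adjoin F0 ?x \<subseteq> F 0"
    using Suc.IH[OF filt_adjoin[OF filt mem(2)]] Suc.prems(2) by auto
  moreover have "F0 \<subset> F 0"
    using F(3) psubset_adjoin[OF filt mem(2) F0(3)] by blast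
  ultimately show ?case
    using F0 \<open>G \<subseteq> F0\<close>
    \<comment> \<open>\<open>case_nat\<close> puts \<open>F0\<close> at index 0 and shifts the chain
      \<open>F\<close> up by one.\<close>
    by (intro exI[of _ "case_nat F0 F"]) (auto split: nat.split)
qed

lemma depth_le_iff:
  "depth_le A imp n \<longleftrightarrow> (\<forall>a. (\<forall>i\<le>n. a i \<in> A) \<longrightarrow> d_term imp n a = \<one>)"
proof
  assume depth: "depth_le A imp n"
  show "\<forall>a. (\<forall>i\<le>n. a i \<in> A) \<longrightarrow> d_term imp n a = \<one>"
  proof (intro allI impI, rule ccontr)
    fix a
    assume a: "\<forall>i\<le>n. a i \<in> A" "d_term imp n a \<noteq> \<one>"
    then have "d_term imp n a \<notin> {\<one>}"
      by simp
    from chain_from_d_term[OF filt_singleton_one a(1) this] depth show False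
      unfolding depth_le_def by (elim exE conjE notE) (intro exI conjI)
  qed
next
  assume d: "\<forall>a. (\<forall>i\<le>n. a i \<in> A) \<longrightarrow> d_term imp n a = \<one>"
  show "depth_le A imp n"
    unfolding depth_le_def
  proof clarify
    fix F
    assume F: "\<forall>i\<le>n. F i \<in> hilbert_dual A imp" "\<forall>i<n. F i \<subset> F (Suc i)"
    from d_term_refuted_by_chain[OF this]
    obtain a where a: "\<forall>i\<le>n. a i \<in> A" "d_term imp n a \<notin> F 0"
      by (elim exE conjE)
    have "filt (F 0)"
      using F(1) by (simp add: mem_hilbert_dual_iff)
    then show False
      using a d filt_one by metis
  qed
qed

end

section \<open>From implicative subreducts to the axioms\<close>

lemma hilbert_algebra_imp_hilbert_system:
  assumes "hilbert_algebra TYPE('b) A imp"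
  obtains one where "hilbert_system A imp one"
proof -
  have "A \<noteq> {}" and closed: "\<And>a b. \<lbrakk>a \<in> A; b \<in> A\<rbrakk> \<Longrightarrow> imp a b \<in> A"
    using assms by (simp_all add: hilbert_algebra_def)
  obtain H :: "'b gorder" and himp h where "heyting_algebra H himp"
    and h: "h ` A \<subseteq> carrier H" "inj_on h A"
    and h_imp: "\<forall>a\<in>A. \<forall>b\<in>A. h (imp a b) = himp (h a) (h b)"
    using assms unfolding hilbert_algebra_def by (elim exE conjE)
  interpret heyting_algebra H himp by fact
  have h_closed: "\<And>a. a \<in> A \<Longrightarrow> h a \<in> carrier H"
    using h by blast
  obtain a0 where a0: "a0 \<in> A"
    using \<open>A \<noteq> {}\<close> by blast
  define one where "one = imp a0 a0"
  have one: "one \<in> A" "h one = \<top>\<^bsub>H\<^esub>"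
    using a0 closed h_imp h_closed by (simp_all add: one_def himp_eq_top_iff)
  \<comment> \<open>Injectivity of \<open>h\<close> reduces each axiom to an equation with the top
    of \<open>H\<close>, that is, to an inequality in \<open>H\<close>.\<close>
  have eq_one: "a = one \<longleftrightarrow> h a = \<top>\<^bsub>H\<^esub>" if "a \<in> A" for a
    using that one h(2) by (metis inj_onD)
  have "hilbert_system A imp one"
  proof
    fix a
    assume "a \<in> A" "imp one a = one"
    then have "\<top>\<^bsub>H\<^esub> \<sqsubseteq>\<^bsub>H\<^esub> h a"
      using one h_imp h_closed himp_eq_top_iff by (metis top_closed)
    then show "a = one"
      using \<open>a \<in> A\<close> eq_one h_closed by (metis le_antisym top_closed top_higher)
  qed (simp_all add: one closed eq_one h_imp h_closed himp_eq_top_iff himp_closed himp_K himp_S)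
  then show thesis
    using that by blast
qed

theorem theorem2p1:
  fixes A :: "'a set" and imp :: "'a \<Rightarrow> 'a \<Rightarrow> 'a" and n :: nat
  assumes "hilbert_algebra TYPE('b) A imp"
  shows "depth_le A imp n \<longleftrightarrow>
    (\<forall>a :: nat \<Rightarrow> 'a. (\<forall>i\<le>n. a i \<in> A) \<longrightarrow> d_term imp n a = hilbert_one A imp)"
proof -
  obtain one where "hilbert_system A imp one"
    using hilbert_algebra_imp_hilbert_system[OF assms] .
  then interpret hilbert_system A imp one .
  show ?thesis
    by (simp add: depth_le_iff hilbert_one_eq)
qed

end
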